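(* Let $d\ge1$ and let $\{B_n\}_{n\ge0}$ be a $d$-symmetric Hahn-classical $d$-OPS. Then for every integer $m\ge0$ the normalized derivative sequence $\{B_n^{[m]}\}_{n\ge0}$ of order $m$ is again a $d$-symmetric Hahn-classical $d$-OPS, and its $d+1$ components are Hahn-classical $d$-OPS.
   Context: All polynomial sequences are monic with complex coefficients, with $n$-th member of degree $n$. A monic sequence $\{P_n\}_{n\ge0}$ is a $d$-orthogonal polynomial sequence ($d$-OPS) if there is a vector of linear forms $(u_0,\dots,u_{d-1})^T$ on complex polynomials such that, for each $0\le t\le d-1$ and all $m\ge0$: $\langle u_t,x^mP_n\rangle=0$ for $n\ge md+t+1$ and $\langle u_t,x^mP_{md+t}\rangle\ne0$. Normalized derivative sequences: $B_n^{[0]}=B_n$, $B_n^{[m+1]}=(B_{n+1}^{[m]})'/(n+1)$. A $d$-OPS is Hahn-classical if its normalized derivative sequence of order one is also a $d$-OPS. A sequence $\{B_n\}$ is $d$-symmetric if $B_n(\xi_kx)=\xi_k^nB_n(x)$ for all $n\ge0$, $0\le k\le d$, where $\xi_k=\exp(2ik\pi/(d+1))$. The components of a $d$-symmetric sequence $\{B_n\}$ are the $d+1$ monic sequences $\{B_n^s\}_{n\ge0}$, $0\le s\le d$, defined by $B_{(d+1)n+s}(x)=x^sB_n^s(x^{d+1})$, $n\ge0$. *)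

theory Defs
  imports Complex_Main "HOL-Computational_Algebra.Polynomial"
begin

definition monic_seq :: "(nat \<Rightarrow> complex poly) \<Rightarrow> bool" where
  "monic_seq P \<longleftrightarrow> (\<forall>n. degree (P n) = n \<and> lead_coeff (P n) = 1)"

definition linear_form :: "(complex poly \<Rightarrow> complex) \<Rightarrow> bool" where
  "linear_form u \<longleftrightarrow> Vector_Spaces.linear smult (*) u"

text \<open>Only the forms \<open>u 0, \<dots>, u (d - 1)\<close> matter; values of \<open>u\<close> at other indices are irrelevant.\<close>

definition d_OPS :: "nat \<Rightarrow> (nat \<Rightarrow> complex poly) \<Rightarrow> bool" where
  "d_OPS d P \<longleftrightarrow> monic_seq P \<and>
     (\<exists>u :: nat \<Rightarrow> complex poly \<Rightarrow> complex. \<forall>t<d. linear_form (u t) \<and>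
        (\<forall>m. (\<forall>n \<ge> m * d + t + 1. u t (monom 1 m * P n) = 0) \<and>
             u t (monom 1 m * P (m * d + t)) \<noteq> 0))"

definition normalized_deriv :: "(nat \<Rightarrow> complex poly) \<Rightarrow> nat \<Rightarrow> complex poly" where
  "normalized_deriv P n = smult (1 / of_nat (n + 1)) (pderiv (P (n + 1)))"

primrec normalized_deriv_seq ::
    "(nat \<Rightarrow> complex poly) \<Rightarrow> nat \<Rightarrow> nat \<Rightarrow> complex poly" where
  "normalized_deriv_seq P 0 = P"
| "normalized_deriv_seq P (Suc m) = normalized_deriv (normalized_deriv_seq P m)"

definition Hahn_classical :: "nat \<Rightarrow> (nat \<Rightarrow> complex poly) \<Rightarrow> bool" where
  "Hahn_classical d P \<longleftrightarrow> d_OPS d P \<and> d_OPS d (normalized_deriv_seq P 1)"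

definition xi :: "nat \<Rightarrow> nat \<Rightarrow> complex" where
  "xi d k = exp (2 * \<i> * of_nat k * of_real pi / of_nat (d + 1))"

definition d_symmetric :: "nat \<Rightarrow> (nat \<Rightarrow> complex poly) \<Rightarrow> bool" where
  "d_symmetric d B \<longleftrightarrow>
     (\<forall>n. \<forall>k\<le>d. \<forall>x. poly (B n) (xi d k * x) = xi d k ^ n * poly (B n) x)"

text \<open>\<open>is_component d B s C\<close>: the sequence \<open>C\<close> is the component of \<open>B\<close> with index \<open>s\<close>.
  It is a relation rather than a function, and single-valued by the lemma that follows.\<close>

definition is_component ::
    "nat \<Rightarrow> (nat \<Rightarrow> complex poly) \<Rightarrow> nat \<Rightarrow> (nat \<Rightarrow> complex poly) \<Rightarrow> bool" where
  "is_component d B s C \<longleftrightarrow> monic_seq C \<and>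
     (\<forall>n x. poly (B ((d + 1) * n + s)) x = x ^ s * poly (C n) (x ^ (d + 1)))"

lemma is_component_unique:
  assumes C: "is_component d B s C" and D: "is_component d B s D"
  shows "C = D"
proof
  fix n
  let ?q = "monom 1 (d + 1) :: complex poly"
  have "monom 1 s * pcompose (C n) ?q = monom 1 s * pcompose (D n) ?q"
    using C D unfolding is_component_def
    by (intro poly_ext) (simp add: poly_monom poly_pcompose)
  then have "pcompose (C n - D n) ?q = 0"
    by (simp add: pcompose_diff)
  then show "C n = D n"
    using pcompose_eq_0[of "C n - D n" ?q] by (simp add: degree_monom_eq)
qed

end

(* A d-symmetric d-OPS P satisfies P (n + 1) = x P n - g n P (n - d) with g n = 0 only for n < d.
   If Q = normalized_deriv P satisfies the same kind of recurrence with coefficients h, then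
   P n = Q n + a n Q (n - d - 1), and comparing the recurrences gives a relation between g and h
   at steps of d that excludes a sequence of critical values of the ratio of h (N - 1) to g N.
   Differentiating the connection formula gives a recurrence for the second derivatives, and on
   components it expresses x T n, for T the normalized derivative of a component, as
   D (n + 1) + c n D n with D a component of Q.  The coefficients that must not vanish for T and
   the second derivatives to be d-orthogonal vanish exactly at the critical ratios. *)

theory Submission imports Defs begin

section \<open>Linear forms and expansions along monic sequences\<close>

lemma linear_formI:
  assumes "\<And>p q. u (p + q) = u p + u q" and "\<And>c p. u (smult c p) = c * u p"
  shows "linear_form u"
proof -
  have "vector_space (smult :: complex \<Rightarrow> _)"
    by unfold_locales (simp_all add: smult_add_right smult_add_left)
  moreover have "vector_space ((*) :: complex \<Rightarrow> _)"
    by unfold_locales (simp_all add: algebra_simps)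
  ultimately show ?thesis
    unfolding linear_form_def Vector_Spaces.linear_def module_hom_def module_hom_axioms_def
      vector_space_def module_def module_pair_def vector_space_pair_def
    using assms by (simp add: algebra_simps)
qed

lemma
  assumes "linear_form u"
  shows linear_form_add: "u (p + q) = u p + u q"
    and linear_form_smult: "u (smult c p) = c * u p"
    and linear_form_diff: "u (p - q) = u p - u q"
    and linear_form_sum: "u (\<Sum>i\<in>A. f i) = (\<Sum>i\<in>A. u (f i))"
    and linear_form_0: "u 0 = 0"
proof -
  interpret module_hom smult "(*)" u
    using assms unfolding linear_form_def Vector_Spaces.linear_def by simp
  show "u (p + q) = u p + u q" "u (smult c p) = c * u p" "u (p - q) = u p - u q"
    "u (\<Sum>i\<in>A. f i) = (\<Sum>i\<in>A. u (f i))" "u 0 = 0"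
    by (fact add scale diff sum zero)+
qed

lemma monom_mult_pCons_0: "monom 1 m * pCons 0 p = monom 1 (Suc m) * p"
  for p :: "'a::comm_semiring_1 poly"
  by (simp add: monom_Suc)

lemma monic_seqD:
  assumes "monic_seq P"
  shows "degree (P n) = n" "coeff (P n) n = 1" "P n \<noteq> 0"
  using assms unfolding monic_seq_def by (metis, metis, metis leading_coeff_0_iff zero_neq_one)

lemma monic_seqI:
  assumes "\<And>n. coeff (P n) n = 1" and "\<And>n i. i > n \<Longrightarrow> coeff (P n) i = 0"
  shows "monic_seq P"
  unfolding monic_seq_def using assms
  by (metis degree_le le_antisym le_degree zero_neq_one)

text \<open>The moment at \<open>x^n\<close> of the form with value \<open>c k\<close> on each
  \<open>P k\<close>. As \<open>P n\<close> is monic, the linear system for the moments is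
  unitriangular and can be solved recursively.\<close>

fun dual_moment :: "(nat \<Rightarrow> complex poly) \<Rightarrow> (nat \<Rightarrow> complex) \<Rightarrow> nat \<Rightarrow> complex" where
  "dual_moment P c n = c n - (\<Sum>i<n. coeff (P n) i * dual_moment P c i)"

declare dual_moment.simps [simp del]

lemma linear_form_on_monic_seq:
  assumes P: "monic_seq P"
  shows "\<exists>u. linear_form u \<and> (\<forall>n. u (P n) = c n)"
proof -
  define u where "u p = (\<Sum>i\<le>degree p. coeff p i * dual_moment P c i)" for p
  \<comment> \<open>Any upper bound on the degree may be used, so \<open>p\<close>, \<open>q\<close>
    and \<open>p + q\<close> can be compared over a common range.\<close>
  have u: "u p = (\<Sum>i\<le>n. coeff p i * dual_moment P c i)" if "degree p \<le> n" for p n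
    unfolding u_def using that
    by (intro sum.mono_neutral_left) (auto simp: coeff_eq_0)
  have "linear_form u"
  proof (rule linear_formI)
    fix p q
    show "u (p + q) = u p + u q"
      using u[of p "max (degree p) (degree q)"] u[of q "max (degree p) (degree q)"]
        u[OF degree_add_le_max, of p q]
      by (simp add: sum.distrib algebra_simps)
  next
    fix a p
    show "u (smult a p) = a * u p"
      using u[OF degree_smult_le, of a p] by (simp add: u_def sum_distrib_left mult.assoc)
  qed
  moreover have "u (P n) = c n" for n
    using P dual_moment.simps[of P c n]
    by (simp add: u_def monic_seqD lessThan_Suc_atMost[symmetric])
  ultimately show ?thesis by blast
qed

text \<open>Subtracting a multiple of \<open>P N\<close> removes the coefficient of index
  \<open>N\<close>. The bound is stated by vanishing coefficients so that \<open>N = 0\<close> means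
  the zero polynomial.\<close>

lemma monic_seq_expansion:
  assumes P: "monic_seq P"
  shows "\<forall>i\<ge>N. coeff q i = 0 \<Longrightarrow> \<exists>c. q = (\<Sum>k<N. smult (c k) (P k))"
proof (induction N arbitrary: q)
  case 0
  then show ?case by (auto intro: poly_eqI)
next
  case (Suc N)
  have "\<forall>i\<ge>N. coeff (q - smult (coeff q N) (P N)) i = 0"
  proof (intro allI impI)
    fix i assume "N \<le> i"
    then consider "i = N" | "i > N" "i \<ge> Suc N" by linarith
    then show "coeff (q - smult (coeff q N) (P N)) i = 0"
      using Suc.prems P by cases (auto simp: monic_seqD coeff_eq_0)
  qed
  from Suc.IH[OF this] obtain c where "q - smult (coeff q N) (P N) = (\<Sum>k<N. smult (c k) (P k))"
    by blast
  then have "q = (\<Sum>k<Suc N. smult ((c(N := coeff q N)) k) (P k))"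
    by (simp add: algebra_simps)
  then show ?case by blast
qed

text \<open>The forms determine the coefficients of an expansion in \<open>P\<close> one after the other,
  since \<open>k = (k div d) * d + k mod d\<close> is the last index not annihilated by the pair
  \<open>(k div d, k mod d)\<close>.\<close>

lemma d_OPS_eq_0:
  assumes d: "d \<ge> 1" and P: "monic_seq P"
    and u: "\<forall>t<d. linear_form (u t) \<and>
        (\<forall>m. (\<forall>n \<ge> m * d + t + 1. u t (monom 1 m * P n) = 0) \<and>
             u t (monom 1 m * P (m * d + t)) \<noteq> 0)"
    and q: "\<forall>i\<ge>N. coeff q i = 0"
    and z: "\<And>m t. t < d \<Longrightarrow> m * d + t < N \<Longrightarrow> u t (monom 1 m * q) = 0"
  shows "q = 0"
proof -
  obtain c where c: "q = (\<Sum>k<N. smult (c k) (P k))"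
    using monic_seq_expansion[OF P q] by blast
  have "k < N \<Longrightarrow> c k = 0" for k
  proof (induction k rule: less_induct)
    case (less k)
    define m t where "m = k div d" and "t = k mod d"
    have k: "k = m * d + t" and t: "t < d"
      using d by (simp_all add: m_def t_def)
    have lin: "linear_form (u t)" using u t by blast
    have "0 = u t (monom 1 m * q)" using z t less.prems k by simp
    also have "\<dots> = (\<Sum>j<N. c j * u t (monom 1 m * P j))"
      by (simp add: c sum_distrib_left linear_form_sum[OF lin] linear_form_smult[OF lin])
    also have "\<dots> = (\<Sum>j\<in>{k}. c j * u t (monom 1 m * P j))"
    proof (rule sum.mono_neutral_right)
      show "\<forall>j\<in>{..<N} - {k}. c j * u t (monom 1 m * P j) = 0"
      proof
        fix j assume j: "j \<in> {..<N} - {k}"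
        then consider "j < k" | "j \<ge> m * d + t + 1" using k by force
        then show "c j * u t (monom 1 m * P j) = 0"
          using less.IH[of j] j u t by cases auto
      qed
    qed (use less.prems in auto)
    finally show "c k = 0" using u t k by auto
  qed
  then show ?thesis using c by simp
qed

section \<open>Symmetry and the recurrence with a single lower term\<close>

text \<open>Comparing coefficients in \<open>P n (z x) = z^n P n x\<close> for
  \<open>z = xi d 1\<close> gives \<open>(z^i - z^n) * coeff (P n) i = 0\<close>. Since
  \<open>z\<close> is a primitive root of unity of order \<open>d + 1\<close>, the factor vanishes
  only for congruent exponents.\<close>

lemma d_symmetric_coeff:
  assumes "d_symmetric d P" and i: "i mod (d + 1) \<noteq> n mod (d + 1)" and "d \<ge> 1"
  shows "coeff (P n) i = 0"
proof -
  let ?z = "xi d 1"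
  have xi_cis: "xi d k = cis (2 * pi * real k / real (d + 1))" for k
    unfolding xi_def cis_conv_exp by (simp add: algebra_simps)
  have "poly (P n \<circ>\<^sub>p [:0, ?z:]) x = poly (smult (?z ^ n) (P n)) x" for x
    using assms unfolding d_symmetric_def by (simp add: poly_pcompose mult.commute)
  then have "P n \<circ>\<^sub>p [:0, ?z:] = smult (?z ^ n) (P n)" by (intro poly_ext)
  then have "coeff (P n \<circ>\<^sub>p [:0, ?z:]) i = coeff (smult (?z ^ n) (P n)) i" by simp
  then have "?z ^ i * coeff (P n) i = ?z ^ n * coeff (P n) i"
    by (simp add: coeff_pcompose_linear)
  moreover have "?z ^ i \<noteq> ?z ^ n"
  proof
    assume eq: "?z ^ i = ?z ^ n"
    have bij: "bij_betw (\<lambda>k. xi d k) {..<d + 1} {z. z ^ (d + 1) = 1}"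
      unfolding xi_cis using bij_betw_roots_unity[of "d + 1"] by simp
    have one: "?z ^ (d + 1) = 1"
      using bij_betwE[OF bij] \<open>d \<ge> 1\<close> by auto
    have pow: "?z ^ j = xi d (j mod (d + 1))" for j
    proof -
      have "?z ^ j = ?z ^ ((d + 1) * (j div (d + 1)) + j mod (d + 1))" by (simp only: mult_div_mod_eq)
      also have "\<dots> = ?z ^ (j mod (d + 1))"
        unfolding power_add[of ?z "(d + 1) * (j div (d + 1))"] power_mult one by simp
      also have "\<dots> = xi d (j mod (d + 1))"
        unfolding xi_cis DeMoivre by (simp add: algebra_simps)
      finally show ?thesis .
    qed
    have "i mod (d + 1) = n mod (d + 1)"
      using inj_onD[OF bij_betw_imp_inj_on[OF bij], of "i mod (d + 1)" "n mod (d + 1)"] eq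
      unfolding pow by simp
    then show False using i by simp
  qed
  ultimately show ?thesis by simp
qed

text \<open>The condition \<open>g n = 0\<close> for \<open>n < d\<close> lets one formula cover the
  initial indices, where \<open>n - d\<close> is truncated to \<open>0\<close>.\<close>

definition symmetric_recurrence ::
    "nat \<Rightarrow> (nat \<Rightarrow> complex poly) \<Rightarrow> (nat \<Rightarrow> complex) \<Rightarrow> bool" where
  "symmetric_recurrence d P g \<longleftrightarrow>
     (\<forall>n. P (Suc n) = pCons 0 (P n) - smult (g n) (P (n - d))) \<and> (\<forall>n. g n = 0 \<longleftrightarrow> n < d)"

text \<open>By monicity and symmetry, \<open>r n = x P n - P (n + 1)\<close> has degree at most
  \<open>n - d\<close>, or is zero if \<open>n < d\<close>. Orthogonality then leaves only a
  multiple of \<open>P (n - d)\<close>, and the regularity condition makes the factor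
  nonzero.\<close>

lemma symmetric_recurrence_exists:
  assumes d: "d \<ge> 1" and "d_OPS d P" and sym: "d_symmetric d P"
  shows "\<exists>g. symmetric_recurrence d P g"
proof -
  obtain u where P: "monic_seq P" and u: "\<forall>t<d. linear_form (u t) \<and>
        (\<forall>m. (\<forall>n \<ge> m * d + t + 1. u t (monom 1 m * P n) = 0) \<and>
             u t (monom 1 m * P (m * d + t)) \<noteq> 0)"
    using assms(2) unfolding d_OPS_def by blast
  define r where "r n = pCons 0 (P n) - P (Suc n)" for n
  have r0: "coeff (r n) i = 0" if "n < i + d" for n i
  proof (cases "i > n")
    case True
    then show ?thesis using P
      by (cases "i = Suc n") (auto simp: r_def coeff_pCons monic_seqD coeff_eq_0 split: nat.split)
  next
    case False
    \<comment> \<open>For \<open>i \<le> n\<close> a congruence would force the positive number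
      \<open>n + 1 - i\<close> to be at least \<open>d + 1\<close>, against
      \<open>n < i + d\<close>.\<close>
    have ne: "i mod (d + 1) \<noteq> Suc n mod (d + 1)"
    proof
      assume "i mod (d + 1) = Suc n mod (d + 1)"
      then have "(d + 1) dvd (Suc n - i)" using False mod_eq_dvd_iff_nat[of i "Suc n" "d + 1"] by simp
      moreover have "0 < Suc n - i" using False by simp
      ultimately have "d + 1 \<le> Suc n - i" by (rule dvd_imp_le)
      then show False using that by simp
    qed
    have "coeff (pCons 0 (P n)) i = 0"
    proof (cases i)
      case (Suc j)
      then have "j mod (d + 1) \<noteq> n mod (d + 1)" using ne by (metis mod_Suc)
      then show ?thesis using d_symmetric_coeff[OF sym _ d, of j n] Suc by simp
    qed simp
    then show ?thesis using d_symmetric_coeff[OF sym ne d] by (simp add: r_def)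
  qed
  have small: "r n = 0" if "n < d" for n
    using r0 that by (intro poly_eqI) simp
  have large: "r n = smult (coeff (r n) (n - d)) (P (n - d)) \<and> coeff (r n) (n - d) \<noteq> 0"
    if "n \<ge> d" for n
  proof -
    let ?c = "coeff (r n) (n - d)"
    let ?q = "r n - smult ?c (P (n - d))"
    have ur: "u t (monom 1 m * r n) = u t (monom 1 (Suc m) * P n)" if "t < d" "m * d + t < Suc n" for m t
    proof -
      have "linear_form (u t)" "u t (monom 1 m * P (Suc n)) = 0" using u that by auto
      then show ?thesis by (simp only: r_def right_diff_distrib monom_mult_pCons_0 linear_form_diff) simp
    qed
    have q: "?q = 0"
    proof (rule d_OPS_eq_0[OF d P u])
      show "\<forall>i\<ge>n - d. coeff ?q i = 0"
      proof (intro allI impI)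
        fix i assume i: "n - d \<le> i"
        show "coeff ?q i = 0"
        proof (cases "i = n - d")
          case True
          then show ?thesis using P by (simp add: monic_seqD)
        next
          case False
          then show ?thesis using i r0[of n i] P by (simp add: monic_seqD coeff_eq_0)
        qed
      qed
      \<comment> \<open>Both parts of \<open>?q\<close> are annihilated:
        \<open>n - d > m * d + t\<close> disposes of \<open>P (n - d)\<close>, and the equivalent
        \<open>n > (m + 1) * d + t\<close> disposes of \<open>x P n\<close>.\<close>
      fix m t assume t: "t < d" "m * d + t < n - d"
      then have lin: "linear_form (u t)" and "u t (monom 1 m * P (n - d)) = 0"
        and "u t (monom 1 (Suc m) * P n) = 0"
        using u by (auto simp del: power_Suc)
      then show "u t (monom 1 m * ?q) = 0"
        using ur[of t m] t by (simp add: right_diff_distrib linear_form_diff linear_form_smult)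
    qed
    then have eq: "r n = smult ?c (P (n - d))" by simp
    have "?c \<noteq> 0"
    proof
      assume "?c = 0"
      then have rn: "r n = 0" using eq by simp
      \<comment> \<open>This pair is the one at which regularity applies to \<open>P n\<close>:
        \<open>n = (m + 1) * d + t\<close>, so \<open>u t\<close> is nonzero on
        \<open>x^(m + 1) P n\<close>.\<close>
      define m t where "m = (n - d) div d" and "t = (n - d) mod d"
      have n: "n = Suc m * d + t" "n - d = m * d + t" and t: "t < d"
        using d that by (simp_all add: m_def t_def)
      have "u t (monom 1 (Suc m) * P n) = 0"
        using ur[OF t, of m] n rn u t by (simp add: linear_form_0)
      then show False using u t n(1) by metis
    qed
    then show ?thesis using eq by blast
  qed
  define g where "g n = (if n < d then 0 else coeff (r n) (n - d))" for n
  have "r n = smult (g n) (P (n - d))" for n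
    using small large[of n] by (simp add: g_def)
  then have "P (Suc n) = pCons 0 (P n) - smult (g n) (P (n - d))" for n
    unfolding r_def by (metis diff_diff_eq2 add_diff_cancel_left')
  moreover have "g n = 0 \<longleftrightarrow> n < d" for n
    using large[of n] by (simp add: g_def)
  ultimately show ?thesis unfolding symmetric_recurrence_def by blast
qed

text \<open>Take \<open>u t\<close> dual to \<open>P\<close> and induct on the power of
  \<open>x\<close>. The recurrence trades each factor \<open>x\<close> for a lowering of the index
  by at most \<open>d\<close>; on the boundary index only the lowered term survives, with factor
  \<open>g n\<close>.\<close>

lemma d_OPS_if_recurrence:
  assumes P: "monic_seq P" and d: "d \<ge> 1"
    and rec: "\<And>n. n \<ge> d \<Longrightarrow> P (Suc n) = pCons 0 (P n) - smult (g n) (P (n - d))"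
    and g: "\<And>n. n \<ge> d \<Longrightarrow> g n \<noteq> 0"
  shows "d_OPS d P"
proof -
  have "\<exists>u. linear_form u \<and> (\<forall>n. u (P n) = (if n = t then 1 else 0))" for t :: nat
    by (rule linear_form_on_monic_seq[OF P])
  then obtain u where lin: "\<And>t::nat. linear_form (u t)"
      and u: "\<And>t n. u t (P n) = (if n = t then 1 else 0)"
    by metis
  have step: "monom 1 (Suc m) * P n = monom 1 m * P (Suc n) + smult (g n) (monom 1 m * P (n - d))"
    if "n \<ge> d" for m n
  proof -
    have "pCons 0 (P n) = P (Suc n) + smult (g n) (P (n - d))"
      using rec[OF that] by simp
    then show ?thesis
      unfolding monom_mult_pCons_0[symmetric] by (simp only: distrib_left mult_smult_right)
  qed
  have "(\<forall>n \<ge> m * d + t + 1. u t (monom 1 m * P n) = 0) \<and> u t (monom 1 m * P (m * d + t)) \<noteq> 0"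
    for m t
  proof (induction m)
    case 0
    then show ?case by (auto simp: u)
  next
    case (Suc m)
    have "u t (monom 1 (Suc m) * P n) = 0" if "n \<ge> Suc m * d + t + 1" for n
    proof -
      have "n \<ge> d" "n - d \<ge> m * d + t + 1" "Suc n \<ge> m * d + t + 1" using that by auto
      then show ?thesis using Suc by (simp only: step linear_form_add[OF lin] linear_form_smult[OF lin]) simp
    qed
    moreover have "u t (monom 1 (Suc m) * P (Suc m * d + t)) \<noteq> 0"
    proof -
      have n: "Suc m * d + t \<ge> d" "Suc m * d + t - d = m * d + t" "Suc (Suc m * d + t) \<ge> m * d + t + 1"
        by auto
      show ?thesis using Suc g[OF n(1)]
        by (simp only: step[OF n(1)] linear_form_add[OF lin] linear_form_smult[OF lin] n(2)) (use n(3) in simp)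
    qed
    ultimately show ?case by blast
  qed
  then show ?thesis unfolding d_OPS_def using P lin by blast
qed


section \<open>Normalized derivatives\<close>

text \<open>At \<open>n = 0\<close> both sides vanish, so the truncated index \<open>n - 1\<close>
  does no harm.\<close>

lemma pderiv_monic_seq:
  assumes "monic_seq P"
  shows "pderiv (P n) = smult (of_nat n) (normalized_deriv P (n - 1))"
proof (cases n)
  case 0
  then show ?thesis using monic_seqD(1)[OF assms, of 0] by (simp add: pderiv_eq_0_iff)
next
  case (Suc k)
  have "(of_nat (Suc k) :: complex) \<noteq> 0" by (rule of_nat_neq_0)
  then show ?thesis using Suc by (simp add: normalized_deriv_def del: of_nat_Suc)
qed

lemma monic_seq_normalized_deriv:
  assumes "monic_seq P"
  shows "monic_seq (normalized_deriv P)"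
proof (rule monic_seqI)
  fix n
  have "(of_nat (Suc n) :: complex) \<noteq> 0" by (rule of_nat_neq_0)
  then show "coeff (normalized_deriv P n) n = 1"
    using monic_seqD(2)[OF assms, of "Suc n"]
    by (simp add: normalized_deriv_def coeff_pderiv del: of_nat_Suc)
next
  fix n i :: nat assume "n < i"
  then show "coeff (normalized_deriv P n) i = 0"
    using monic_seqD(1)[OF assms, of "Suc n"]
    by (simp add: normalized_deriv_def coeff_pderiv coeff_eq_0)
qed

text \<open>Differentiating the symmetry relation of \<open>P (n + 1)\<close> produces one factor
  \<open>xi d k\<close> on the left, which is cancelled against
  \<open>xi d k ^ (n + 1)\<close>.\<close>

lemma d_symmetric_normalized_deriv:
  assumes "d_symmetric d P"
  shows "d_symmetric d (normalized_deriv P)"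
  unfolding d_symmetric_def
proof (intro allI impI)
  fix n k x assume k: "k \<le> d"
  let ?z = "xi d k" and ?p = "P (Suc n)"
  have z: "?z \<noteq> 0" by (simp add: xi_def)
  have "poly (?p \<circ>\<^sub>p [:0, ?z:]) y = poly (smult (?z ^ Suc n) ?p) y" for y
    using assms k unfolding d_symmetric_def by (simp add: poly_pcompose mult.commute)
  then have "?p \<circ>\<^sub>p [:0, ?z:] = smult (?z ^ Suc n) ?p" by (intro poly_ext)
  then have "pderiv (?p \<circ>\<^sub>p [:0, ?z:]) = pderiv (smult (?z ^ Suc n) ?p)" by simp
  then have "poly (pderiv (?p \<circ>\<^sub>p [:0, ?z:])) x = poly (pderiv (smult (?z ^ Suc n) ?p)) x" by simp
  then have "poly (pderiv ?p) (?z * x) * ?z = ?z ^ n * poly (pderiv ?p) x * ?z"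
    by (simp add: pderiv_pcompose pderiv_pCons pderiv_smult poly_pcompose algebra_simps)
  then have "poly (pderiv ?p) (?z * x) = ?z ^ n * poly (pderiv ?p) x" using z by simp
  then show "poly (normalized_deriv P n) (?z * x) = ?z ^ n * poly (normalized_deriv P n) x"
    by (simp add: normalized_deriv_def)
qed

section \<open>Recurrence coefficients of a sequence and of its derivative\<close>

locale symmetric_Hahn =
  fixes d :: nat and P :: "nat \<Rightarrow> complex poly" and g h :: "nat \<Rightarrow> complex"
  assumes d: "d \<ge> 1" and P: "monic_seq P"
    and rec_P: "symmetric_recurrence d P g"
    and rec_Q: "symmetric_recurrence d (normalized_deriv P) h"
begin

abbreviation "Q \<equiv> normalized_deriv P"

text \<open>The connection coefficient of \<open>P\<close> in terms of \<open>Q\<close>. It is zero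
  for \<open>n \<le> d\<close>, where the index \<open>n - Suc d\<close> is truncated.\<close>

definition a :: "nat \<Rightarrow> complex" where
  "a n = (of_nat n - of_nat d) * g n - of_nat n * h (n - 1)"

lemma Q: "monic_seq Q"
  by (rule monic_seq_normalized_deriv[OF P])

lemma P_Suc: "P (Suc n) = pCons 0 (P n) - smult (g n) (P (n - d))"
  and Q_Suc: "Q (Suc n) = pCons 0 (Q n) - smult (h n) (Q (n - d))"
  and g_eq_0: "g n = 0 \<longleftrightarrow> n < d" and h_eq_0: "h n = 0 \<longleftrightarrow> n < d"
  using rec_P rec_Q unfolding symmetric_recurrence_def by blast+

text \<open>The derivative of the recurrence of \<open>P\<close> involves \<open>Q n\<close>,
  \<open>x Q (n - 1)\<close>, \<open>Q (n - d - 1)\<close> and \<open>P n\<close>; the recurrence of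
  \<open>Q\<close> eliminates \<open>x Q (n - 1)\<close>.\<close>

lemma P_eq_Q: "P n = Q n + smult (a n) (Q (n - Suc d))"
proof (rule poly_ext)
  fix x
  \<comment> \<open>For \<open>n < d\<close> the truncated and the complex difference disagree, but
    then \<open>g n = 0\<close>.\<close>
  have gd: "g n * of_nat (n - d) = g n * (of_nat n - of_nat d)"
    using g_eq_0[of n] by (cases "n < d") (auto simp: of_nat_diff)
  have "pderiv (P (Suc n)) = pderiv (pCons 0 (P n) - smult (g n) (P (n - d)))"
    by (simp only: P_Suc)
  then have "of_nat (Suc n) * poly (Q n) x = poly (P n) x + x * (of_nat n * poly (Q (n - 1)) x)
      - (g n * of_nat (n - d)) * poly (Q (n - Suc d)) x"
    unfolding pderiv_monic_seq[OF P] pderiv_diff pderiv_pCons pderiv_smult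
    by (auto dest!: arg_cong[of _ _ "\<lambda>p. poly p x"] simp: algebra_simps)
  moreover have "of_nat n * poly (Q n) x
      = of_nat n * (x * poly (Q (n - 1)) x - h (n - 1) * poly (Q (n - Suc d)) x)"
  proof (cases n)
    case (Suc k)
    then show ?thesis by (simp add: Q_Suc)
  qed simp
  ultimately show "poly (P n) x = poly (Q n + smult (a n) (Q (n - Suc d))) x"
    unfolding gd of_nat_Suc a_def poly_add poly_smult by algebra
qed

text \<open>Writing the recurrence of \<open>P\<close> at index \<open>N + d\<close> in terms of
  \<open>Q\<close> leaves a combination of \<open>Q N\<close> and \<open>Q (N - d - 1)\<close>.
  These have different degrees, so both coefficients vanish; the second gives the claim.\<close>

lemma coefficient_compatibility:
  assumes N: "d < N"
  shows "a (N + d) * h (N - 1) = g (N + d) * a N"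
proof -
  let ?n = "N + d" and ?M = "N - Suc d"
  let ?\<alpha> = "a (Suc ?n) - h ?n - a ?n + g ?n" and ?\<beta> = "g ?n * a N - a ?n * h (N - 1)"
  have zero: "smult ?\<alpha> (Q N) + smult ?\<beta> (Q ?M) = 0"
  proof (rule poly_ext)
    fix x
    have "poly (P (Suc ?n)) x = x * poly (P ?n) x - g ?n * poly (P N) x"
      by (simp add: P_Suc)
    moreover have "poly (P (Suc ?n)) x = poly (Q (Suc ?n)) x + a (Suc ?n) * poly (Q N) x"
      by (subst P_eq_Q) simp
    moreover have "poly (P ?n) x = poly (Q ?n) x + a ?n * poly (Q (N - 1)) x"
      by (subst P_eq_Q) simp
    moreover have "poly (P N) x = poly (Q N) x + a N * poly (Q ?M) x"
      by (subst P_eq_Q) simp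
    moreover have "poly (Q (Suc ?n)) x = x * poly (Q ?n) x - h ?n * poly (Q N) x"
      by (simp add: Q_Suc)
    moreover have "poly (Q N) x = x * poly (Q (N - 1)) x - h (N - 1) * poly (Q ?M) x"
      using N Q_Suc[of "N - 1"] by simp
    ultimately show "poly (smult ?\<alpha> (Q N) + smult ?\<beta> (Q ?M)) x = poly 0 x"
      by simp algebra
  qed
  have "coeff (Q ?M) N = 0" using N Q by (simp add: monic_seqD coeff_eq_0)
  then have "?\<alpha> = 0" using arg_cong[OF zero, of "\<lambda>p. coeff p N"] Q by (simp add: monic_seqD)
  then have "smult ?\<beta> (Q ?M) = 0" using zero by (metis add_0 smult_0_left)
  then have "?\<beta> = 0" using Q by (simp add: monic_seqD)
  then show ?thesis by simp
qed

text \<open>In terms of \<open>\<sigma> N = N h (N - 1) / ((N - d) g N)\<close>, the compatibility relation is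
  \<open>\<sigma> (N + d) = 2 - 1 / \<sigma> N\<close>, which maps \<open>(s + 1) / (s + 2)\<close> to \<open>s / (s + 1)\<close> and so
  would eventually reach the forbidden value \<open>0\<close>.\<close>

lemma coefficient_ratio:
  assumes "d < N"
  shows "of_nat (Suc s) * (of_nat N * h (N - 1)) \<noteq> of_nat s * ((of_nat N - of_nat d) * g N)"
  using assms
proof (induction s arbitrary: N)
  case 0
  then show ?case using h_eq_0[of "N - 1"] by auto
next
  case (Suc s)
  show ?case
  proof
    assume eq: "of_nat (Suc (Suc s)) * (of_nat N * h (N - 1))
      = of_nat (Suc s) * ((of_nat N - of_nat d) * g N)"
    have "h (N - 1) \<noteq> 0" using Suc.prems h_eq_0[of "N - 1"] by auto
    have "(of_nat N * g (N + d) - (of_nat N + of_nat d) * h (N + d - 1)) * h (N - 1)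
      = g (N + d) * ((of_nat N - of_nat d) * g N - of_nat N * h (N - 1))"
      using coefficient_compatibility[OF Suc.prems] by (simp add: a_def)
    \<comment> \<open>After multiplication by \<open>s + 1\<close>, \<open>eq\<close> turns the
      right-hand side into \<open>N * g (N + d) * h (N - 1)\<close>. As
      \<open>(N + d) - d = N\<close>, the result is the relation excluded for \<open>s\<close> at
      \<open>N + d\<close>, times \<open>h (N - 1)\<close>.\<close>
    then have "of_nat (Suc s) * ((of_nat N + of_nat d) * h (N + d - 1)) * h (N - 1)
      = of_nat s * (of_nat N * g (N + d)) * h (N - 1)"
      using eq unfolding of_nat_Suc by algebra
    then have "of_nat (Suc s) * ((of_nat N + of_nat d) * h (N + d - 1)) = of_nat s * (of_nat N * g (N + d))"
      using \<open>h (N - 1) \<noteq> 0\<close> by simp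
    then show False using Suc.IH[of "N + d"] Suc.prems by simp
  qed
qed

text \<open>With \<open>k = n + 1\<close>, the derivative of the recurrence of \<open>Q\<close>
  contains \<open>Q k\<close>. The derivative of \<open>P_eq_Q\<close> expresses \<open>Q k\<close>
  by \<open>?R k\<close> and \<open>?R (n - d)\<close>; eliminating it gives a recurrence for
  \<open>?R\<close>, whose coefficient is \<open>e n\<close>.\<close>

lemma d_OPS_second_deriv: "d_OPS d (normalized_deriv Q)"
proof -
  let ?R = "normalized_deriv Q"
  define e where "e n = (of_nat (Suc n) - of_nat d) * (h (Suc n) - a (n + 2) / of_nat (n + 2))
      / of_nat (Suc n)" for n
  have nz: "(of_nat (Suc n) :: complex) \<noteq> 0" for n by (rule of_nat_neq_0)
  show ?thesis
  proof (rule d_OPS_if_recurrence[OF monic_seq_normalized_deriv[OF Q] d])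
    fix n assume n: "d \<le> n"
    let ?k = "Suc n"
    show "?R ?k = pCons 0 (?R n) - smult (e n) (?R (n - d))"
    proof (rule poly_ext)
      fix x
      have kd: "(of_nat (?k - d) :: complex) = of_nat ?k - of_nat d" using n by (simp add: of_nat_diff)
      have "pderiv (Q (Suc ?k)) = pderiv (pCons 0 (Q ?k) - smult (h ?k) (Q (?k - d)))"
        by (simp only: Q_Suc)
      then have 1: "of_nat (Suc ?k) * poly (?R ?k) x = poly (Q ?k) x + x * (of_nat ?k * poly (?R n) x)
          - h ?k * ((of_nat ?k - of_nat d) * poly (?R (n - d)) x)"
        unfolding pderiv_monic_seq[OF Q] pderiv_diff pderiv_pCons pderiv_smult kd
        by (auto dest!: arg_cong[of _ _ "\<lambda>p. poly p x"] simp: algebra_simps)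
      have "pderiv (P (Suc ?k)) = pderiv (Q (Suc ?k) + smult (a (Suc ?k)) (Q (?k - d)))"
        using P_eq_Q[of "Suc ?k"] by simp
      then have 2: "of_nat (Suc ?k) * poly (Q ?k) x = of_nat (Suc ?k) * poly (?R ?k) x
          + a (Suc ?k) * ((of_nat ?k - of_nat d) * poly (?R (n - d)) x)"
        unfolding pderiv_monic_seq[OF Q] pderiv_monic_seq[OF P] pderiv_add pderiv_smult kd
        by (auto dest!: arg_cong[of _ _ "\<lambda>p. poly p x"] simp: algebra_simps)
      define b where "b = a (Suc ?k) / of_nat (Suc ?k)"
      have a: "a (Suc ?k) = b * of_nat (Suc ?k)" using nz[of ?k] by (simp add: b_def del: of_nat_Suc)
      have 3: "e n * of_nat ?k = (of_nat ?k - of_nat d) * (h ?k - b)"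
        using nz[of n] by (simp add: e_def b_def del: of_nat_Suc)
      have "of_nat (Suc ?k) * poly (Q ?k) x = of_nat (Suc ?k) * (poly (?R ?k) x
          + b * ((of_nat ?k - of_nat d) * poly (?R (n - d)) x))"
        using 2 unfolding a by algebra
      then have 4: "poly (Q ?k) x = poly (?R ?k) x + b * ((of_nat ?k - of_nat d) * poly (?R (n - d)) x)"
        using nz[of ?k] by (simp del: of_nat_Suc)
      have "of_nat ?k * poly (?R ?k) x = of_nat ?k * (x * poly (?R n) x - e n * poly (?R (n - d)) x)"
        using 1 3 4 unfolding of_nat_Suc[of ?k] by algebra
      then have "poly (?R ?k) x = x * poly (?R n) x - e n * poly (?R (n - d)) x"
        using nz[of n] by (simp del: of_nat_Suc)
      then show "poly (?R ?k) x = poly (pCons 0 (?R n) - smult (e n) (?R (n - d))) x" by simp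
    qed
    have "(of_nat ?k :: complex) \<noteq> of_nat d" using n by (simp del: of_nat_Suc)
    \<comment> \<open>Vanishing would mean \<open>2 N h (N - 1) = (N - d) g N\<close> for
      \<open>N = n + 2\<close>, the critical ratio with \<open>s = 1\<close>.\<close>
    moreover have "h ?k - a (n + 2) / of_nat (n + 2) \<noteq> 0"
    proof
      assume "h ?k - a (n + 2) / of_nat (n + 2) = 0"
      then have "h ?k * of_nat (n + 2) = a (n + 2)"
        using nz[of ?k] by (simp add: field_simps del: of_nat_Suc)
      then show False
        using coefficient_ratio[of "n + 2" 1] n by (simp add: a_def algebra_simps)
    qed
    ultimately show "e n \<noteq> 0" using nz[of n] by (simp add: e_def del: of_nat_Suc)
  qed
qed

end

section \<open>Components of a symmetric sequence\<close>

text \<open>Turns the component relation into an equation of polynomials. The map is linear and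
  injective, so identities between components may be proved for their lifts.\<close>

definition lift_component :: "nat \<Rightarrow> nat \<Rightarrow> complex poly \<Rightarrow> complex poly" where
  "lift_component d s p = monom 1 s * (p \<circ>\<^sub>p monom 1 (d + 1))"

lemma lift_component_add: "lift_component d s (p + q) = lift_component d s p + lift_component d s q"
  and lift_component_smult: "lift_component d s (smult c p) = smult c (lift_component d s p)"
  by (simp_all add: lift_component_def pcompose_add pcompose_smult algebra_simps)

lemma lift_component_monom_mult:
  "lift_component d s (monom 1 m * p) = monom 1 ((d + 1) * m) * lift_component d s p"
  by (intro poly_ext)
    (simp add: lift_component_def poly_pcompose poly_monom power_mult[symmetric] power_add algebra_simps)

lemma lift_component_inject: "lift_component d s p = lift_component d s q \<longleftrightarrow> p = q"
proof
  assume "lift_component d s p = lift_component d s q"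
  then have "(p - q) \<circ>\<^sub>p monom 1 (d + 1) = 0"
    by (simp add: lift_component_def pcompose_diff)
  then show "p = q"
    using pcompose_eq_0[of "p - q" "monom 1 (d + 1)"] by (simp add: degree_monom_eq)
qed simp

text \<open>For \<open>y = x^(d + 1)\<close> the Euler operator \<open>x d/dx\<close> equals
  \<open>(d + 1) y d/dy\<close> on functions of \<open>y\<close>, and the factor \<open>x^s\<close>
  is an eigenvector with eigenvalue \<open>s\<close>.\<close>

lemma Euler_lift_component:
  "pCons 0 (pderiv (lift_component d s p))
    = smult (of_nat s) (lift_component d s p)
      + smult (of_nat (d + 1)) (lift_component d s (pCons 0 (pderiv p)))"
proof (rule poly_ext)
  fix x :: complex
  have s: "x * (of_nat s * x ^ (s - 1)) = of_nat s * x ^ s" by (cases s) simp_all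
  have "x * poly (pderiv (lift_component d s p)) x
    = (x * (of_nat s * x ^ (s - 1))) * poly p (x ^ (d + 1))
      + x ^ s * (of_nat (d + 1) * (x ^ (d + 1) * poly (pderiv p) (x ^ (d + 1))))"
    by (simp add: lift_component_def pderiv_mult pderiv_pcompose pderiv_monom poly_monom
        poly_pcompose algebra_simps)
  then show "poly (pCons 0 (pderiv (lift_component d s p))) x
    = poly (smult (of_nat s) (lift_component d s p)
      + smult (of_nat (d + 1)) (lift_component d s (pCons 0 (pderiv p)))) x"
    unfolding s by (simp add: lift_component_def poly_monom poly_pcompose algebra_simps)
qed

lemma is_component_iff:
  "is_component d B s C \<longleftrightarrow> monic_seq C \<and> (\<forall>n. B ((d + 1) * n + s) = lift_component d s (C n))"
  unfolding is_component_def lift_component_def poly_eq_poly_eq_iff[symmetric] fun_eq_iff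
  by (simp add: poly_monom poly_pcompose)

text \<open>The component collects the coefficients at exponents \<open>(d + 1) * j + s\<close>. By
  symmetry all others vanish, \<open>s\<close> being the residue of the index because
  \<open>s \<le> d\<close>.\<close>

lemma is_component_exists:
  assumes d: "d \<ge> 1" and B: "monic_seq B" "d_symmetric d B" and s: "s \<le> d"
  shows "\<exists>C. is_component d B s C"
proof -
  define C where "C n = (\<Sum>j\<le>n. monom (coeff (B ((d + 1) * n + s)) ((d + 1) * j + s)) j)" for n
  have coeff_C: "coeff (C n) j = (if j \<le> n then coeff (B ((d + 1) * n + s)) ((d + 1) * j + s) else 0)" for n j
    by (simp add: C_def coeff_sum)
  have "monic_seq C"
    using monic_seqD[OF B(1)] by (intro monic_seqI) (simp_all add: coeff_C)
  moreover have "poly (B ((d + 1) * n + s)) x = x ^ s * poly (C n) (x ^ (d + 1))" for n x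
  proof -
    let ?N = "(d + 1) * n + s"
    let ?f = "\<lambda>j. (d + 1) * j + s"
    have "poly (B ?N) x = (\<Sum>i\<le>?N. coeff (B ?N) i * x ^ i)"
      using monic_seqD(1)[OF B(1)] by (simp add: poly_altdef)
    also have "\<dots> = (\<Sum>i\<in>?f ` {..n}. coeff (B ?N) i * x ^ i)"
    proof (rule sum.mono_neutral_right)
      show "?f ` {..n} \<subseteq> {..?N}" by (auto simp del: mult_Suc add_Suc_right)
      show "\<forall>i\<in>{..?N} - ?f ` {..n}. coeff (B ?N) i * x ^ i = 0"
      proof
        fix i assume i: "i \<in> {..?N} - ?f ` {..n}"
        have "i mod (d + 1) \<noteq> ?N mod (d + 1)"
        proof
          assume "i mod (d + 1) = ?N mod (d + 1)"
          moreover have "?N mod (d + 1) = s" using s by (simp only: mod_mult_self4) simp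
          ultimately have "i = ?f (i div (d + 1))" by (metis mult_div_mod_eq)
          moreover from this i have "i div (d + 1) \<le> n"
            by (metis Diff_iff atMost_iff add_le_cancel_right mult_le_cancel1 zero_less_Suc Suc_eq_plus1)
          ultimately show False using i by blast
        qed
        then show "coeff (B ?N) i * x ^ i = 0" using d_symmetric_coeff[OF B(2) _ d] by simp
      qed
    qed simp
    also have "\<dots> = (\<Sum>j\<le>n. coeff (B ?N) (?f j) * x ^ ?f j)"
      by (subst sum.reindex) (auto simp: inj_on_def simp del: mult_Suc mult_Suc_right)
    also have "\<dots> = x ^ s * poly (C n) (x ^ (d + 1))"
      by (simp only: C_def poly_sum poly_monom power_add power_mult sum_distrib_left) (simp add: mult_ac)
    finally show ?thesis .
  qed
  ultimately show ?thesis unfolding is_component_def by blast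
qed

text \<open>The form of the component with index \<open>t\<close> is \<open>u r\<close> shifted by the power \<open>x ^ k\<close>, with
  \<open>d * k + r = (d + 1) * t + s\<close>, so that the degree thresholds match exactly.\<close>

lemma d_OPS_component:
  assumes d: "d \<ge> 1" and B: "d_OPS d B" and C: "is_component d B s C"
  shows "d_OPS d C"
proof -
  obtain u where u: "\<forall>t<d. linear_form (u t) \<and>
        (\<forall>m. (\<forall>n \<ge> m * d + t + 1. u t (monom 1 m * B n) = 0) \<and>
             u t (monom 1 m * B (m * d + t)) \<noteq> 0)"
    using B unfolding d_OPS_def by blast
  define r k where "r t = ((d + 1) * t + s) mod d" and "k t = ((d + 1) * t + s) div d" for t
  define v where "v t p = u (r t) (monom 1 (k t) * lift_component d s p)" for t p
  have r: "r t < d" and rk: "k t * d + r t = (d + 1) * t + s" for t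
    using d by (simp_all add: r_def k_def del: mult_Suc)
  have lin: "linear_form (v t)" for t
  proof -
    have lin_u: "linear_form (u (r t))" using u r by blast
    show ?thesis
      by (rule linear_formI)
        (simp_all add: v_def lift_component_add lift_component_smult distrib_left
          linear_form_add[OF lin_u] linear_form_smult[OF lin_u])
  qed
  have v: "v t (monom 1 m * C n) = u (r t) (monom 1 (k t + (d + 1) * m) * B ((d + 1) * n + s))" for t m n
  proof -
    have "monom 1 (k t) * (monom 1 ((d + 1) * m) * p) = monom 1 (k t + (d + 1) * m) * p"
      for p :: "complex poly"
      by (simp only: mult.assoc[symmetric] mult_monom mult_1_left)
    then show ?thesis
      using C by (simp only: v_def is_component_iff lift_component_monom_mult)
  qed
  have idx: "(k t + (d + 1) * m) * d + r t = (d + 1) * (m * d + t) + s" for t m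
    using rk[of t] by (simp add: algebra_simps)
  have "v t (monom 1 m * C n) = 0" if "n \<ge> m * d + t + 1" for t m n
  proof -
    have "(d + 1) * n \<ge> (d + 1) * (m * d + t + 1)" using that by (rule mult_le_mono2)
    then have "(d + 1) * n + s \<ge> (k t + (d + 1) * m) * d + r t + 1"
      unfolding idx by (simp add: algebra_simps)
    then show ?thesis unfolding v using u r by blast
  qed
  moreover have "v t (monom 1 m * C (m * d + t)) \<noteq> 0" for t m
    unfolding v idx[symmetric] using u r by blast
  ultimately show ?thesis
    using C lin unfolding d_OPS_def is_component_def by blast
qed

text \<open>The forms for \<open>T\<close> are those for \<open>D\<close> precomposed with
  multiplication by \<open>x\<close>. On the boundary index \<open>m * d + t\<close> the term with
  \<open>D (Suc n)\<close> vanishes and the other is \<open>c n\<close> times a nonzero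
  value.\<close>

lemma d_OPS_kernel:
  assumes D: "d_OPS d D" and T: "monic_seq T"
    and eq: "\<And>n. pCons 0 (T n) = D (Suc n) + smult (c n) (D n)" and c: "\<And>n. c n \<noteq> 0"
  shows "d_OPS d T"
proof -
  obtain u where u: "\<forall>t<d. linear_form (u t) \<and>
        (\<forall>m. (\<forall>n \<ge> m * d + t + 1. u t (monom 1 m * D n) = 0) \<and>
             u t (monom 1 m * D (m * d + t)) \<noteq> 0)"
    using D unfolding d_OPS_def by blast
  define w where "w t p = u t (pCons 0 p)" for t p
  have "linear_form (w t) \<and> (\<forall>m. (\<forall>n \<ge> m * d + t + 1. w t (monom 1 m * T n) = 0) \<and>
             w t (monom 1 m * T (m * d + t)) \<noteq> 0)" if t: "t < d" for t
  proof -
    have lin: "linear_form (u t)" using u t by blast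
    have "w t (p + q) = w t p + w t q" for p q
      using linear_form_add[OF lin, of "pCons 0 p" "pCons 0 q"] by (simp add: w_def)
    moreover have "w t (smult b p) = b * w t p" for b p
      using linear_form_smult[OF lin, of b "pCons 0 p"] by (simp add: w_def)
    ultimately have "linear_form (w t)" by (rule linear_formI)
    moreover have "w t (monom 1 m * T n) = u t (monom 1 m * D (Suc n)) + c n * u t (monom 1 m * D n)" for m n
    proof -
      have "pCons 0 (monom 1 m * T n) = monom 1 m * pCons 0 (T n)" by simp
      also have "\<dots> = monom 1 m * D (Suc n) + smult (c n) (monom 1 m * D n)"
        by (simp only: eq distrib_left mult_smult_right)
      finally show ?thesis by (simp add: w_def linear_form_add[OF lin] linear_form_smult[OF lin])
    qed
    ultimately show ?thesis using u t c by simp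
  qed
  then show ?thesis using T unfolding d_OPS_def by blast
qed

section \<open>Derivatives of components\<close>

context symmetric_Hahn
begin

text \<open>The product \<open>x P'\<close> at index \<open>N n\<close> is computed twice: by the
  Euler formula, and as \<open>N n\<close> times \<open>x Q (N n - 1)\<close>, rewritten by the
  recurrence of \<open>Q\<close>. The connection formula then removes \<open>P\<close>, and on
  components \<open>x T\<close> is a combination of two neighbouring members of \<open>D\<close>, so
  \<open>d_OPS_kernel\<close> applies.\<close>

lemma d_OPS_component_deriv:
  assumes Q_OPS: "d_OPS d Q" and C: "is_component d P s C" and D: "is_component d Q s D"
  shows "d_OPS d (normalized_deriv C)"
proof -
  let ?T = "normalized_deriv C"
  define N where "N n = (d + 1) * Suc n + s" for n
  define k where "k n = N n * h (N n - 1) - s * a (N n)" for n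
  define c where "c n = k n / of_nat ((d + 1) * Suc n)" for n
  have mC: "monic_seq C" using C by (simp add: is_component_iff)
  have nz: "(of_nat ((d + 1) * Suc n) :: complex) \<noteq> 0" for n
    by (simp only: of_nat_eq_0_iff) simp
  \<comment> \<open>For \<open>N = N n\<close>, unfolding \<open>a\<close> gives
    \<open>k n = (s + 1) N h (N - 1) - s (N - d) g N\<close>, whose vanishing is the critical ratio
    with parameter \<open>s\<close>.\<close>
  have "k n \<noteq> 0" for n
    using coefficient_ratio[of "N n" s] by (simp add: k_def a_def N_def algebra_simps)
  then have c0: "c n \<noteq> 0" for n using nz by (simp add: c_def del: of_nat_mult)
  show ?thesis
  proof (rule d_OPS_kernel[OF d_OPS_component[OF d Q_OPS D] monic_seq_normalized_deriv[OF mC] _ c0])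
    fix n
    let ?L = "lift_component d s"
    have PN: "P (N n) = ?L (C (Suc n))" unfolding N_def using C by (simp only: is_component_iff)
    have QN: "Q (N n) = ?L (D (Suc n))" unfolding N_def using D by (simp only: is_component_iff)
    have idx: "N n - Suc d = (d + 1) * n + s" by (simp add: N_def)
    have QN': "Q (N n - Suc d) = ?L (D n)" unfolding idx using D by (simp only: is_component_iff)
    have "?L (pCons 0 (smult (of_nat ((d + 1) * Suc n)) (?T n)))
      = ?L (smult (of_nat ((d + 1) * Suc n)) (D (Suc n)) + smult (k n) (D n))"
    proof (rule poly_ext)
      fix x
      let ?y = "\<lambda>p. poly (?L p) x"
      have T: "pCons 0 (smult (of_nat ((d + 1) * Suc n)) (?T n))
        = smult (of_nat (d + 1)) (pCons 0 (pderiv (C (Suc n))))"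
        unfolding pderiv_monic_seq[OF mC] by (simp add: algebra_simps)
      have "x * poly (pderiv (P (N n))) x
        = of_nat s * ?y (C (Suc n)) + of_nat (d + 1) * ?y (pCons 0 (pderiv (C (Suc n))))"
        using Euler_lift_component[of d s "C (Suc n)"] unfolding PN
        by (auto dest!: arg_cong[of _ _ "\<lambda>p. poly p x"])
      moreover have "poly (pderiv (P (N n))) x = of_nat (N n) * poly (Q (N n - 1)) x"
        unfolding pderiv_monic_seq[OF P] by simp
      moreover have "?y (D (Suc n)) = x * poly (Q (N n - 1)) x - h (N n - 1) * ?y (D n)"
        using Q_Suc[of "N n - 1"] unfolding QN[symmetric] QN'[symmetric] by (simp add: N_def)
      moreover have "?y (C (Suc n)) = ?y (D (Suc n)) + a (N n) * ?y (D n)"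
        unfolding PN[symmetric] QN[symmetric] QN'[symmetric] by (subst P_eq_Q) simp
      \<comment> \<open>Subtracting the Euler term with factor \<open>s\<close> from
        \<open>N n\<close> leaves \<open>(d + 1) * (n + 1)\<close>, the same factor as on the left,
        which can therefore be divided out afterwards.\<close>
      moreover have "of_nat (N n) = (of_nat ((d + 1) * Suc n) + of_nat s :: complex)"
        by (simp add: N_def)
      ultimately show "?y (pCons 0 (smult (of_nat ((d + 1) * Suc n)) (?T n)))
        = ?y (smult (of_nat ((d + 1) * Suc n)) (D (Suc n)) + smult (k n) (D n))"
        unfolding T lift_component_add lift_component_smult poly_add poly_smult k_def by algebra
    qed
    then have "pCons 0 (smult (of_nat ((d + 1) * Suc n)) (?T n))
      = smult (of_nat ((d + 1) * Suc n)) (D (Suc n) + smult (c n) (D n))"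
      using nz[of n] by (simp add: lift_component_inject smult_add_right c_def del: of_nat_mult)
    then have "smult (of_nat ((d + 1) * Suc n)) (pCons 0 (?T n))
      = smult (of_nat ((d + 1) * Suc n)) (D (Suc n) + smult (c n) (D n))"
      by (simp only: smult_pCons mult_zero_right)
    then have "smult (of_nat ((d + 1) * Suc n)) (pCons 0 (?T n) - (D (Suc n) + smult (c n) (D n))) = 0"
      by (simp only: smult_diff_right diff_self)
    then have "pCons 0 (?T n) - (D (Suc n) + smult (c n) (D n)) = 0"
      unfolding smult_eq_0_iff using nz[of n] by blast
    then show "pCons 0 (?T n) = D (Suc n) + smult (c n) (D n)"
      unfolding right_minus_eq .
  qed
qed

end

section \<open>Passage to derivatives of every order\<close>

lemma symmetric_Hahn_exists:
  assumes "d \<ge> 1" "d_symmetric d P" "Hahn_classical d P"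
  shows "\<exists>g h. symmetric_Hahn d P g h"
proof -
  have P: "d_OPS d P" and Q: "d_OPS d (normalized_deriv P)"
    using assms(3) by (simp_all add: Hahn_classical_def)
  show ?thesis
    using symmetric_recurrence_exists[OF assms(1) P assms(2)]
      symmetric_recurrence_exists[OF assms(1) Q d_symmetric_normalized_deriv[OF assms(2)]] P assms(1)
    unfolding symmetric_Hahn_def d_OPS_def by blast
qed

lemma Hahn_classical_normalized_deriv:
  assumes "d \<ge> 1" "d_symmetric d P" "Hahn_classical d P"
  shows "Hahn_classical d (normalized_deriv P)"
  using symmetric_Hahn_exists[OF assms] symmetric_Hahn.d_OPS_second_deriv assms(3)
  by (auto simp: Hahn_classical_def)

text \<open>By \<open>is_component_unique\<close> the existential statement concerns the only
  component of index \<open>s\<close>.\<close>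

lemma Hahn_classical_component:
  assumes d: "d \<ge> 1" and sym: "d_symmetric d P" and H: "Hahn_classical d P" and s: "s \<le> d"
  shows "\<exists>C. is_component d P s C \<and> Hahn_classical d C"
proof -
  have P: "d_OPS d P" and Q: "d_OPS d (normalized_deriv P)"
    using H by (simp_all add: Hahn_classical_def)
  obtain C where C: "is_component d P s C"
    using is_component_exists[OF d _ sym s] P unfolding d_OPS_def by blast
  obtain D where D: "is_component d (normalized_deriv P) s D"
    using is_component_exists[OF d _ d_symmetric_normalized_deriv[OF sym] s] Q
    unfolding d_OPS_def by blast
  have "d_OPS d (normalized_deriv C)"
    using symmetric_Hahn_exists[OF d sym H] symmetric_Hahn.d_OPS_component_deriv[OF _ Q C D] by blast
  then show ?thesis
    using C d_OPS_component[OF d P C] by (auto simp: Hahn_classical_def)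
qed

theorem theorem8p1:
  fixes d :: nat and B :: "nat \<Rightarrow> complex poly"
  assumes "d \<ge> 1"
    and "d_symmetric d B"
    and "Hahn_classical d B"
  shows "\<forall>m. d_symmetric d (normalized_deriv_seq B m) \<and>
             Hahn_classical d (normalized_deriv_seq B m) \<and>
             (\<forall>s\<le>d. \<exists>C. is_component d (normalized_deriv_seq B m) s C \<and>
                         Hahn_classical d C)"
proof
  fix m
  have "d_symmetric d (normalized_deriv_seq B m) \<and> Hahn_classical d (normalized_deriv_seq B m)"
  proof (induction m)
    case (Suc m)
    then show ?case
      using d_symmetric_normalized_deriv Hahn_classical_normalized_deriv[OF assms(1)] by simp
  qed (use assms in simp)
  then show "d_symmetric d (normalized_deriv_seq B m) \<and> Hahn_classical d (normalized_deriv_seq B m) \<and>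
      (\<forall>s\<le>d. \<exists>C. is_component d (normalized_deriv_seq B m) s C \<and> Hahn_classical d C)"
    using Hahn_classical_component[OF assms(1)] by blast
qed

end
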